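(* For every odd integer $k\geq 3$, the graph $J_k$ has a Fulkerson covering.
   Context: For odd $k\geq 3$, $J_k$ is the cubic graph on the $4k$ vertices $x_0,\dots,x_{k-1}$, $y_0,\dots,y_{k-1}$, $z_0,\dots,z_{k-1}$, $t_0,\dots,t_{k-1}$ whose edges are: the edges of the cycle $x_0x_1\cdots x_{k-1}x_0$ (length $k$), the edges of the cycle $y_0y_1\cdots y_{k-1}z_0z_1\cdots z_{k-1}y_0$ (length $2k$), and for each $i=0,\dots,k-1$ the three edges $t_ix_i$, $t_iy_i$, $t_iz_i$. A Fulkerson covering of a graph $G$ is a family of $6$ perfect matchings $M_1,\dots,M_6$ of $G$ (not necessarily distinct) such that every edge of $G$ lies in exactly two of them. *)

theory Defs
  imports Main
begin

text \<open>
  A finite simple graph is given by its vertex set \<open>V\<close> and its edge set \<open>E\<close>, an edge being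
  the two-element set of its endpoints.
\<close>

definition simple_graph :: "'a set \<Rightarrow> 'a set set \<Rightarrow> bool" where
  "simple_graph V E \<longleftrightarrow> finite V \<and> (\<forall>e\<in>E. e \<subseteq> V \<and> card e = 2)"

definition matching :: "'a set set \<Rightarrow> 'a set set \<Rightarrow> bool" where
  "matching E M \<longleftrightarrow> M \<subseteq> E \<and> pairwise disjnt M"

definition perfect_matching :: "'a set \<Rightarrow> 'a set set \<Rightarrow> 'a set set \<Rightarrow> bool" where
  "perfect_matching V E M \<longleftrightarrow> matching E M \<and> \<Union>M = V"

text \<open>The members are indexed by \<open>{1..6}\<close>, so repetitions in the family are allowed and
  are counted with multiplicity.\<close>

definition fulkerson_covering ::
  "'a set \<Rightarrow> 'a set set \<Rightarrow> (nat \<Rightarrow> 'a set set) \<Rightarrow> bool" where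
  "fulkerson_covering V E M \<longleftrightarrow>
     (\<forall>i\<in>{1..6}. perfect_matching V E (M i)) \<and>
     (\<forall>e\<in>E. card {i\<in>{1..6}. e \<in> M i} = 2)"

definition has_fulkerson_covering :: "'a set \<Rightarrow> 'a set set \<Rightarrow> bool" where
  "has_fulkerson_covering V E \<longleftrightarrow> (\<exists>M. fulkerson_covering V E M)"

definition cycle_edges :: "'a list \<Rightarrow> 'a set set" where
  "cycle_edges vs = {{vs ! i, vs ! (Suc i mod length vs)} | i. i < length vs}"

datatype flower_vertex = X nat | Y nat | Z nat | T nat

definition J_verts :: "nat \<Rightarrow> flower_vertex set" where
  "J_verts k = X ` {0..<k} \<union> Y ` {0..<k} \<union> Z ` {0..<k} \<union> T ` {0..<k}"

definition J_edges :: "nat \<Rightarrow> flower_vertex set set" where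
  "J_edges k =
     cycle_edges (map X [0..<k]) \<union>
     cycle_edges (map Y [0..<k] @ map Z [0..<k]) \<union>
     (\<Union>i\<in>{0..<k}. {{T i, X i}, {T i, Y i}, {T i, Z i}})"

lemma card_J_verts: "card (J_verts k) = 4 * k"
proof -
  have "card (J_verts k) = card (X ` {0..<k}) + card (Y ` {0..<k})
    + card (Z ` {0..<k}) + card (T ` {0..<k})"
    unfolding J_verts_def by (subst card_Un_disjoint; auto)+
  then show ?thesis
    by (simp add: card_image inj_on_def)
qed

lemma cycle_edges_simple:
  assumes "distinct vs" "length vs \<ge> 2" "e \<in> cycle_edges vs"
  shows "e \<subseteq> set vs \<and> card e = 2"
proof -
  obtain i where i: "i < length vs" "e = {vs ! i, vs ! (Suc i mod length vs)}"
    using assms(3) by (auto simp: cycle_edges_def)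
  have l: "Suc i mod length vs < length vs" using assms(2) by (intro mod_less_divisor) auto
  have "Suc i mod length vs \<noteq> i"
    using i(1) assms(2) by (cases "Suc i = length vs") auto
  then have "vs ! i \<noteq> vs ! (Suc i mod length vs)"
    using i(1) l assms(1) nth_eq_iff_index_eq by metis
  then show ?thesis using i l by auto
qed

lemma simple_graph_J:
  assumes "k \<ge> 3"
  shows "simple_graph (J_verts k) (J_edges k)"
  unfolding simple_graph_def
proof (intro conjI ballI)
  show "finite (J_verts k)" by (simp add: J_verts_def)
next
  fix e assume "e \<in> J_edges k"
  then consider "e \<in> cycle_edges (map X [0..<k])"
    | "e \<in> cycle_edges (map Y [0..<k] @ map Z [0..<k])"
    | i where "i < k" "e \<in> {{T i, X i}, {T i, Y i}, {T i, Z i}}"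
    by (auto simp: J_edges_def)
  then have "e \<subseteq> J_verts k \<and> card e = 2"
  proof cases
    case 1
    have "e \<subseteq> set (map X [0..<k]) \<and> card e = 2"
      using assms by (intro cycle_edges_simple[OF _ _ 1]) (auto simp: distinct_map inj_on_def)
    then show ?thesis by (auto simp: J_verts_def)
  next
    case 2
    have "e \<subseteq> set (map Y [0..<k] @ map Z [0..<k]) \<and> card e = 2"
      using assms by (intro cycle_edges_simple[OF _ _ 2]) (auto simp: distinct_map inj_on_def)
    then show ?thesis by (auto simp: J_verts_def)
  next
    case 3
    then show ?thesis by (auto simp: J_verts_def)
  qed
  then show "e \<subseteq> J_verts k" "card e = 2" by auto
qed

end

theory Submission
  imports Defs
begin

text \<open>
  A Fulkerson covering of a cubic graph amounts to a labelling of the edges by two-element subsets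
  of \<open>{1..6}\<close> such that the three labels at each vertex partition \<open>{1..6}\<close>; the \<open>m\<close>-th perfect
  matching consists of the edges whose label contains \<open>m\<close>.
  Cut \<open>J\<^sub>k\<close> into the \<open>k\<close> claws around the vertices \<open>t\<^sub>i\<close>. The labels of the three edges leaving a
  claw towards the next one form a triple, ordered as (\<open>x\<close>, \<open>y\<close>, \<open>z\<close>), and we write \<open>p \<rightarrow> q\<close> if the
  edges of a claw with incoming triple \<open>p\<close> and outgoing triple \<open>q\<close> can be labelled. This relation is
  symmetric. With \<open>s = (12, 34, 56)\<close>, \<open>t = (35, 16, 24)\<close> and \<open>u = (46, 23, 15)\<close> one has
  \<open>(12, 56, 34) \<rightarrow> u \<rightarrow> t \<rightarrow> s \<rightarrow> t \<rightarrow> s \<rightarrow> \<dots>\<close>. The first triple is \<open>s\<close> with its \<open>y\<close> and \<open>z\<close> entries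
  swapped, which is the effect of the twist of the \<open>2k\<close>-cycle, and \<open>s\<close> is reached after every odd
  number \<open>k \<ge> 3\<close> of steps.
\<close>

text \<open>Two pairs that share a vertex coincide, because \<open>f\<close> is its own inverse on
  \<open>V\<close>.\<close>

lemma perfect_matching_involution:
  assumes edge: "\<And>v. v \<in> V \<Longrightarrow> {v, f v} \<in> E"
    and closed: "\<And>v. v \<in> V \<Longrightarrow> f v \<in> V"
    and invol: "\<And>v. v \<in> V \<Longrightarrow> f (f v) = v"
  shows "perfect_matching V E {{v, f v} | v. v \<in> V}"
proof -
  have "{v, f v} = {w, f w}" if vw: "v \<in> V" "w \<in> V" "{v, f v} \<inter> {w, f w} \<noteq> {}" for v w
  proof -
    consider "v = w" | "v = f w" | "f v = w" | "f v = f w" using vw(3) by blast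
    then show ?thesis
      using invol[OF vw(1)] invol[OF vw(2)] by cases (metis insert_commute)+
  qed
  then have "pairwise disjnt {{v, f v} | v. v \<in> V}"
    unfolding pairwise_def disjnt_def by blast
  then show ?thesis
    using edge closed by (auto simp: perfect_matching_def matching_def)
qed

text \<open>Since \<open>f m\<close> is an involution, membership of an edge in the
  \<open>m\<close>-th matching can be tested at either endpoint, so counting at one
  suffices.\<close>

lemma has_fulkerson_covering_involutions:
  assumes edge: "\<And>m v. m \<in> {1..6::nat} \<Longrightarrow> v \<in> V \<Longrightarrow> {v, f m v} \<in> E"
    and closed: "\<And>m v. m \<in> {1..6} \<Longrightarrow> v \<in> V \<Longrightarrow> f m v \<in> V"
    and invol: "\<And>m v. m \<in> {1..6} \<Longrightarrow> v \<in> V \<Longrightarrow> f m (f m v) = v"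
    and twice: "\<And>e. e \<in> E \<Longrightarrow> \<exists>u\<in>V. \<exists>v. e = {u, v} \<and> card {m \<in> {1..6}. f m u = v} = 2"
  shows "has_fulkerson_covering V E"
proof -
  define M where "M m = {{v, f m v} | v. v \<in> V}" for m
  have "card {m \<in> {1..6}. e \<in> M m} = 2" if e: "e \<in> E" for e
  proof -
    obtain u v where uv: "u \<in> V" "e = {u, v}" "card {m \<in> {1..6}. f m u = v} = 2"
      using twice[OF e] by blast
    have "e \<in> M m \<longleftrightarrow> f m u = v" if "m \<in> {1..6}" for m
      using uv(1,2) invol[OF that] by (auto simp: M_def doubleton_eq_iff)
    then have "{m \<in> {1..6}. e \<in> M m} = {m \<in> {1..6}. f m u = v}" by blast
    then show ?thesis using uv(3) by simp
  qed
  moreover have "perfect_matching V E (M m)" if "m \<in> {1..6}" for m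
    unfolding M_def using that edge closed invol by (intro perfect_matching_involution) auto
  ultimately show ?thesis
    unfolding has_fulkerson_covering_def fulkerson_covering_def by blast
qed

definition rim :: "nat \<Rightarrow> flower_vertex set" where
  "rim k = X ` {0..<k} \<union> Y ` {0..<k} \<union> Z ` {0..<k}"

fun claw_index :: "flower_vertex \<Rightarrow> nat" where
  "claw_index (X i) = i"
| "claw_index (Y i) = i"
| "claw_index (Z i) = i"
| "claw_index (T i) = i"

text \<open>The values of \<open>nxt\<close> and \<open>prv\<close> at \<open>T i\<close>, which lies on neither cycle, are junk.\<close>

fun nxt :: "nat \<Rightarrow> flower_vertex \<Rightarrow> flower_vertex" where
  "nxt k (X i) = (if Suc i = k then X 0 else X (Suc i))"
| "nxt k (Y i) = (if Suc i = k then Z 0 else Y (Suc i))"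
| "nxt k (Z i) = (if Suc i = k then Y 0 else Z (Suc i))"
| "nxt k (T i) = T i"

fun prv :: "nat \<Rightarrow> flower_vertex \<Rightarrow> flower_vertex" where
  "prv k (X i) = (if i = 0 then X (k - 1) else X (i - 1))"
| "prv k (Y i) = (if i = 0 then Z (k - 1) else Y (i - 1))"
| "prv k (Z i) = (if i = 0 then Y (k - 1) else Z (i - 1))"
| "prv k (T i) = T i"

text \<open>\<open>cycle_label v\<close> is the label of the edge from \<open>v\<close> to its successor, and \<open>spoke_label v\<close> the
  label of the edge from \<open>v\<close> to the centre of its claw.\<close>

fun cycle_label :: "flower_vertex \<Rightarrow> nat set" where
  "cycle_label (X i) = (if i = 0 then {4, 6} else if odd i then {3, 5} else {1, 2})"
| "cycle_label (Y i) = (if i = 0 then {2, 3} else if odd i then {1, 6} else {3, 4})"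
| "cycle_label (Z i) = (if i = 0 then {1, 5} else if odd i then {2, 4} else {5, 6})"
| "cycle_label (T i) = {}"

fun spoke_label :: "flower_vertex \<Rightarrow> nat set" where
  "spoke_label (X i) = (if i = 0 then {3, 5} else if i = 1 then {1, 2} else {4, 6})"
| "spoke_label (Y i) = (if i = 0 then {1, 4} else if i = 1 then {4, 5} else {2, 5})"
| "spoke_label (Z i) = (if i = 0 then {2, 6} else if i = 1 then {3, 6} else {1, 3})"
| "spoke_label (T i) = {}"

text \<open>The other end of the edge whose label contains \<open>m\<close>; the last branches work
  by elimination, as the labels at a vertex partition \<open>{1..6}\<close>.\<close>

fun partner :: "nat \<Rightarrow> nat \<Rightarrow> flower_vertex \<Rightarrow> flower_vertex" where
  "partner k m (T i) =
     (if m \<in> spoke_label (X i) then X i else if m \<in> spoke_label (Y i) then Y i else Z i)"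
| "partner k m v =
     (if m \<in> cycle_label v then nxt k v
      else if m \<in> spoke_label v then T (claw_index v) else prv k v)"

lemma partner_rim:
  assumes "v \<in> rim k"
  shows "partner k m v = (if m \<in> cycle_label v then nxt k v
      else if m \<in> spoke_label v then T (claw_index v) else prv k v)"
  using assms by (cases v) (auto simp: rim_def)

lemma J_verts_rim: "J_verts k = rim k \<union> T ` {0..<k}"
  by (auto simp: J_verts_def rim_def)

lemma cycle_edges_X: "cycle_edges (map X [0..<k]) = (\<lambda>v. {v, nxt k v}) ` X ` {0..<k}"
proof -
  have "{map X [0..<k] ! i, map X [0..<k] ! (Suc i mod length (map X [0..<k]))} = {X i, nxt k (X i)}"
    if "i < k" for i
    using that by (cases "Suc i = k") auto
  then have "cycle_edges (map X [0..<k]) = (\<lambda>i. {X i, nxt k (X i)}) ` {0..<k}"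
    unfolding cycle_edges_def setcompr_eq_image by (intro image_cong) auto
  then show ?thesis unfolding image_image .
qed

lemma cycle_edges_YZ:
  "cycle_edges (map Y [0..<k] @ map Z [0..<k]) =
     (\<lambda>v. {v, nxt k v}) ` (Y ` {0..<k} \<union> Z ` {0..<k})"
proof -
  define vs where "vs = map Y [0..<k] @ map Z [0..<k]"
  have len: "length vs = k + k" by (simp add: vs_def)
  have Y: "{vs ! i, vs ! (Suc i mod (k + k))} = {Y i, nxt k (Y i)}" if "i < k" for i
    using that by (cases "Suc i = k") (auto simp: vs_def nth_append)
  have Z: "{vs ! (k + i), vs ! (Suc (k + i) mod (k + k))} = {Z i, nxt k (Z i)}" if "i < k" for i
    using that by (cases "Suc i = k") (auto simp: vs_def nth_append)
  have "cycle_edges vs = (\<lambda>i. {vs ! i, vs ! (Suc i mod (k + k))}) ` {0..<k + k}"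
    by (auto simp: cycle_edges_def len)
  also have "{0..<k + k} = {0..<k} \<union> (+) k ` {0..<k}"
    by (simp add: ivl_disj_un_two(3) add.commute)
  also have "(\<lambda>i. {vs ! i, vs ! (Suc i mod (k + k))}) ` \<dots> =
      (\<lambda>i. {Y i, nxt k (Y i)}) ` {0..<k} \<union> (\<lambda>i. {Z i, nxt k (Z i)}) ` {0..<k}"
    unfolding image_Un image_image using Y Z by (intro arg_cong2[of _ _ _ _ "(\<union>)"] image_cong) auto
  finally show ?thesis
    unfolding vs_def image_Un image_image .
qed

lemma J_edges_rim:
  "J_edges k = (\<lambda>v. {v, nxt k v}) ` rim k \<union> (\<lambda>v. {v, T (claw_index v)}) ` rim k"
  unfolding J_edges_def cycle_edges_X cycle_edges_YZ rim_def
  by (auto simp: image_Un image_image insert_commute simp del: nxt.simps)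

lemma nxt_prv_rim:
  assumes "k \<ge> 3" "v \<in> rim k"
  shows "nxt k v \<in> rim k" "prv k v \<in> rim k" "nxt k (prv k v) = v" "prv k (nxt k v) = v"
    "prv k v \<noteq> nxt k v"
proof -
  obtain i where i: "i < k" "v = X i \<or> v = Y i \<or> v = Z i"
    using assms(2) by (auto simp: rim_def)
  then show "prv k v \<noteq> nxt k v"
    using assms(1) by (cases "i = 0"; cases "Suc i = k") auto
qed (use assms in \<open>auto simp: rim_def\<close>)

lemma not_T_rim: "v \<in> rim k \<Longrightarrow> v \<noteq> T i"
  by (auto simp: rim_def)

text \<open>The oddness of \<open>k\<close> enters through the labels of \<open>X (k - 1)\<close>, \<open>Y (k - 1)\<close>, \<open>Z (k - 1)\<close>.\<close>

lemma labels_partition_rim: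
  assumes "odd k" "k \<ge> 3" "v \<in> rim k"
  shows "cycle_label v \<inter> spoke_label v = {}"
    and "cycle_label (prv k v) = {1..6} - cycle_label v - spoke_label v"
proof -
  have six: "{1..6::nat} = {1, 2, 3, 4, 5, 6}" by auto
  show "cycle_label v \<inter> spoke_label v = {}"
    using assms(3) by (auto simp: rim_def split: if_splits)
  obtain i where i: "i < k" "v = X i \<or> v = Y i \<or> v = Z i"
    using assms(3) by (auto simp: rim_def)
  \<comment> \<open>For \<open>i = 0\<close> the predecessor lies across the twist, in claw
    \<open>k - 1\<close>; for \<open>i = 1\<close> it carries the exceptional labels of claw 0;
    afterwards the labels alternate with parity.\<close>
  consider "i = 0" | "i = 1" | "i > 1" by linarith
  then show "cycle_label (prv k v) = {1..6} - cycle_label v - spoke_label v"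
  proof cases
    case 1
    then show ?thesis using i assms(1,2) unfolding six by auto
  next
    case 2
    then show ?thesis using i unfolding six by auto
  next
    case 3
    then show ?thesis using i unfolding six by (cases "odd i") auto
  qed
qed

lemma card_labels_rim:
  assumes "v \<in> rim k"
  shows "card (cycle_label v) = 2" "card (spoke_label v) = 2"
    "cycle_label v \<subseteq> {1..6}" "spoke_label v \<subseteq> {1..6}"
  using assms by (auto simp: rim_def split: if_splits)

lemma spoke_labels_partition:
  "spoke_label (X i) \<inter> spoke_label (Y i) = {}"
  "spoke_label (Z i) = {1..6} - spoke_label (X i) - spoke_label (Y i)"
  by auto

lemma partner_T:
  assumes "m \<in> {1..6}" "i < k"
  shows "partner k m (T i) \<in> rim k" "claw_index (partner k m (T i)) = i"
    "m \<in> spoke_label (partner k m (T i))"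
  using assms spoke_labels_partition[of i] by (auto simp: rim_def simp del: spoke_label.simps)

lemma partner_T_eq:
  assumes "v \<in> rim k" "m \<in> spoke_label v"
  shows "partner k m (T (claw_index v)) = v"
  using assms spoke_labels_partition[of "claw_index v"]
  by (auto simp: rim_def simp del: spoke_label.simps)

theorem theorem3p1:
  fixes k :: nat
  assumes "odd k" and "k \<ge> 3"
  shows "has_fulkerson_covering (J_verts k) (J_edges k)"
proof (rule has_fulkerson_covering_involutions[where f = "partner k"])
  note rim = nxt_prv_rim[OF \<open>k \<ge> 3\<close>] and part = labels_partition_rim[OF assms]
  have idx: "claw_index v < k" if "v \<in> rim k" for v
    using that by (auto simp: rim_def)
  have cycle_edge: "{v, nxt k v} \<in> J_edges k" and spoke: "{v, T (claw_index v)} \<in> J_edges k"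
    if "v \<in> rim k" for v
    using that by (auto simp: J_edges_rim)
  have prv_edge: "{v, prv k v} \<in> J_edges k" if "v \<in> rim k" for v
    using cycle_edge[of "prv k v"] rim[OF that] by (simp add: insert_commute)

  fix m v assume m: "m \<in> {1..6::nat}" and "v \<in> J_verts k"
  then consider "v \<in> rim k" | i where "v = T i" "i < k"
    by (auto simp: J_verts_rim)
  then have "{v, partner k m v} \<in> J_edges k \<and> partner k m v \<in> J_verts k \<and>
      partner k m (partner k m v) = v"
  proof cases
    case 1
    consider "m \<in> cycle_label v" | "m \<notin> cycle_label v" "m \<in> spoke_label v"
      | "m \<notin> cycle_label v" "m \<notin> spoke_label v" by blast
    then show ?thesis
    proof cases
      case c: 1
      \<comment> \<open>The partition at \<open>nxt k v\<close> has \<open>cycle_label v\<close> as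
        its third part, so \<open>partner\<close> leads back to \<open>v\<close>.\<close>
      have "m \<notin> cycle_label (nxt k v)" "m \<notin> spoke_label (nxt k v)"
        using part(2)[of "nxt k v"] rim[OF 1] c by auto
      then show ?thesis
        using 1 c rim[OF 1] cycle_edge by (simp add: partner_rim J_verts_rim del: partner.simps)
    next
      case c: 2
      then show ?thesis
        using 1 idx spoke partner_T_eq[OF 1] by (simp add: partner_rim J_verts_rim del: partner.simps)
    next
      case c: 3
      then have "m \<in> cycle_label (prv k v)"
        using part(2)[OF 1] m by auto
      then show ?thesis
        using 1 c rim[OF 1] prv_edge by (simp add: partner_rim J_verts_rim del: partner.simps)
    qed
  next
    case 2
    define w where "w = partner k m (T i)"
    have w: "w \<in> rim k" "claw_index w = i" "m \<in> spoke_label w"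
      unfolding w_def using partner_T[OF m 2(2)] by blast+
    then have "m \<notin> cycle_label w" using part(1) by blast
    then show ?thesis
      using w spoke[OF w(1)] 2(1) by (simp add: partner_rim J_verts_rim insert_commute flip: w_def del: partner.simps)
  qed
  then show "{v, partner k m v} \<in> J_edges k" "partner k m v \<in> J_verts k"
    "partner k m (partner k m v) = v" by auto
next
  note rim = nxt_prv_rim[OF \<open>k \<ge> 3\<close>] and part = labels_partition_rim[OF assms]
  fix e assume "e \<in> J_edges k"
  then obtain v where v: "v \<in> rim k" and e: "e = {v, nxt k v} \<or> e = {v, T (claw_index v)}"
    by (auto simp: J_edges_rim)
  \<comment> \<open>The three neighbours of \<open>v\<close> are distinct, so each determines its
    branch of \<open>partner\<close>.\<close>
  have "{m \<in> {1..6}. partner k m v = nxt k v} = cycle_label v"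
    "{m \<in> {1..6}. partner k m v = T (claw_index v)} = spoke_label v"
    using rim(5)[OF v] part(1)[OF v] card_labels_rim(3,4)[OF v]
      not_T_rim[OF rim(1)[OF v], of "claw_index v"] not_T_rim[OF rim(2)[OF v], of "claw_index v"]
    by (auto simp: partner_rim[OF v] dest: sym split: if_splits)
  then show "\<exists>u\<in>J_verts k. \<exists>w. e = {u, w} \<and> card {m \<in> {1..6}. partner k m u = w} = 2"
    using e v card_labels_rim(1,2)[OF v] by (intro bexI[of _ v]) (auto simp: J_verts_rim)
qed

end
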